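(* Let $1\le\delta<\Delta$ be integers, $\tilde h:\mathbb{Z}^+\to\mathbb{R}^+$ a positive non-increasing function and $\mathcal{J}(G)=\sum_{u\in V(G)}\tilde h(d_u)$. Let $G$ be minimal for $\mathcal{J}$ (among graphs with minimum degree $\delta$ and maximum degree $\Delta$). Then: if $\delta\Delta$ is even, $\Delta+1\le|V(G)|\le\Delta+2$; if $\delta\Delta$ is odd and $2\tilde h(\Delta)>\tilde h(\Delta-1)$, $\Delta+1\le|V(G)|\le\Delta+2$; if $\delta\Delta$ is odd and $2\tilde h(\Delta)\le\tilde h(\Delta-1)$, $\Delta+1\le|V(G)|\le\Delta+3$.
   Context: All graphs are finite, simple and have at least one edge; $d_u$ is the degree of $u$. A graph $G$ with minimum degree $\delta$ and maximum degree $\Delta$ is minimal for $\mathcal{J}$ if $\mathcal{J}(G)\le\mathcal{J}(\Gamma)$ for every graph $\Gamma$ with minimum degree $\delta$ and maximum degree $\Delta$. *)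

theory Defs
  imports Complex_Main "Graph_Theory.Pair_Digraph"
begin

text \<open>A locale \<open>pair_graph\<close> instance is a finite loop-free symmetric digraph whose arcs are pairs
  of vertices: a finite simple graph, each edge \<open>uv\<close> being represented by the two arcs
  \<open>(u, v)\<close> and \<open>(v, u)\<close>.  Hence the number of neighbours of \<open>u\<close> is its out-degree.\<close>

definition simple_graph :: "'a pair_pre_digraph \<Rightarrow> bool" where
  "simple_graph G \<longleftrightarrow> pair_graph G \<and> parcs G \<noteq> {}"

definition degree :: "'a pair_pre_digraph \<Rightarrow> 'a \<Rightarrow> nat" where
  "degree G u = out_degree (with_proj G) u"

definition min_degree :: "'a pair_pre_digraph \<Rightarrow> nat" where
  "min_degree G = Min (degree G ` pverts G)"

definition max_degree :: "'a pair_pre_digraph \<Rightarrow> nat" where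
  "max_degree G = Max (degree G ` pverts G)"

definition graph_with_degrees :: "nat \<Rightarrow> nat \<Rightarrow> 'a pair_pre_digraph \<Rightarrow> bool" where
  "graph_with_degrees \<delta> \<Delta> G \<longleftrightarrow> simple_graph G \<and> min_degree G = \<delta> \<and> max_degree G = \<Delta>"

definition vertex_index :: "(nat \<Rightarrow> real) \<Rightarrow> 'a pair_pre_digraph \<Rightarrow> real" where
  "vertex_index h G = (\<Sum>u\<in>pverts G. h (degree G u))"

text \<open>The competitors \<open>\<Gamma>\<close> are graphs on finite sets of natural numbers; as every finite graph is
  isomorphic to such a graph, they represent all finite graphs, whatever the vertex type of \<open>G\<close>.\<close>

definition minimal_graph :: "(nat \<Rightarrow> real) \<Rightarrow> nat \<Rightarrow> nat \<Rightarrow> 'a pair_pre_digraph \<Rightarrow> bool" where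
  "minimal_graph h \<delta> \<Delta> G \<longleftrightarrow>
     graph_with_degrees \<delta> \<Delta> G \<and>
     (\<forall>\<Gamma> :: nat pair_pre_digraph.
        graph_with_degrees \<delta> \<Delta> \<Gamma> \<longrightarrow> vertex_index h G \<le> vertex_index h \<Gamma>)"

end

theory Submission
  imports Defs
begin

text \<open>A graph with \<open>n\<close> vertices has \<open>J \<ge> h \<delta> + (n - 1) h \<Delta>\<close>, so an almost \<open>\<Delta>\<close>-regular competitor
  with few vertices bounds \<open>n\<close>.  Competitors are built from their sparse complements.  On \<open>\<Delta> + 2\<close>
  vertices the degrees are \<open>\<delta>\<close> once and \<open>\<Delta>\<close> otherwise if \<open>\<delta>\<close> is even; if \<open>\<delta>\<close> is odd, one further
  vertex drops to degree \<open>\<Delta> - 1\<close>.  If \<open>\<delta>\<close> and \<open>\<Delta>\<close> are odd, this defect disappears on \<open>\<Delta> + 3\<close>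
  vertices; if \<open>\<delta>\<close> is odd and \<open>\<Delta>\<close> even, every graph pays for it by the handshake lemma.\<close>

section \<open>Degrees and the handshake lemma\<close>

lemma degree_eq_card: "degree G u = card {v. (u, v) \<in> parcs G}"
proof -
  have "out_arcs (with_proj G) u = Pair u ` {v. (u, v) \<in> parcs G}"
    by (force simp: out_arcs_def)
  then show ?thesis
    by (simp add: degree_def out_degree_def card_image inj_on_def)
qed

lemma (in pair_graph) degree_less_card:
  assumes "u \<in> pverts G"
  shows "degree G u < card (pverts G)"
proof -
  have "{v. (u, v) \<in> parcs G} \<subset> pverts G"
    using assms in_arcsD2 no_loops' by blast
  then show ?thesis
    unfolding degree_eq_card using pair_finite_verts by (rule psubset_card_mono[rotated])
qed

text \<open>Swapping pairs up the two arcs of each edge. As \<open>'a\<close> carries no order, an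
  injection \<open>f\<close> into the naturals selects one arc of each pair.\<close>

lemma (in pair_graph) even_card_parcs: "even (card (parcs G))"
proof -
  obtain f :: "'a \<Rightarrow> nat" where f: "inj_on f (pverts G)"
    using finite_imp_inj_to_nat_seg[OF pair_finite_verts] by blast
  define A where "A = {(u, v) \<in> parcs G. f u < f v}"
  have parts: "parcs G = A \<union> prod.swap ` A"
  proof (intro equalityI subsetI)
    fix e assume e: "e \<in> parcs G"
    obtain u v where uv: "e = (u, v)" by force
    then have "f u \<noteq> f v"
      using e f in_arcsD1 in_arcsD2 no_loops' by (metis inj_onD)
    then show "e \<in> A \<union> prod.swap ` A"
      using e arcs_symmetric unfolding A_def uv by (force simp: image_iff)
  qed (auto simp: A_def arcs_symmetric)
  have "finite A"
    using pair_finite_arcs by (rule rev_finite_subset) (auto simp: A_def)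
  moreover have "A \<inter> prod.swap ` A = {}"
    by (auto simp: A_def)
  ultimately have "card (parcs G) = card A + card A"
    unfolding parts by (simp add: card_Un_disjoint card_image)
  then show ?thesis by simp
qed

lemma (in pair_graph) even_sum_degree: "even (\<Sum>u\<in>pverts G. degree G u)"
proof -
  have "parcs G = Sigma (pverts G) (\<lambda>u. {v. (u, v) \<in> parcs G})"
    using in_arcsD1 by auto
  moreover have "finite {v. (u, v) \<in> parcs G}" for u
    using pair_finite_verts by (rule rev_finite_subset) (auto dest: in_arcsD2)
  ultimately have "card (parcs G) = (\<Sum>u\<in>pverts G. degree G u)"
    using card_SigmaI[OF pair_finite_verts] unfolding degree_eq_card by metis
  then show ?thesis using even_card_parcs by simp
qed

section \<open>Pointwise form of the degree conditions\<close>

lemma graph_with_degreesI: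
  assumes "pair_graph G"
    and "\<And>u. u \<in> pverts G \<Longrightarrow> \<delta> \<le> degree G u \<and> degree G u \<le> \<Delta>"
    and "u \<in> pverts G" "degree G u = \<delta>"
    and "v \<in> pverts G" "degree G v = \<Delta>" "0 < \<Delta>"
  shows "graph_with_degrees \<delta> \<Delta> G"
proof -
  have fin: "finite (pverts G)"
    using assms(1) by (simp add: pair_fin_digraph.pair_finite_verts pair_graph_def pair_digraph_def)
  have "parcs G \<noteq> {}"
    using assms(6,7) by (auto simp: degree_eq_card)
  moreover have "min_degree G = \<delta>"
    unfolding min_degree_def using fin assms by (intro Min_eqI) auto
  moreover have "max_degree G = \<Delta>"
    unfolding max_degree_def using fin assms by (intro Max_eqI) auto
  ultimately show ?thesis
    using assms(1) by (simp add: graph_with_degrees_def simple_graph_def)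
qed

lemma graph_with_degreesD:
  assumes "graph_with_degrees \<delta> \<Delta> G"
  shows graph_with_degrees_pair_graph: "pair_graph G"
    and graph_with_degrees_finite: "finite (pverts G)"
    and graph_with_degrees_le: "u \<in> pverts G \<Longrightarrow> \<delta> \<le> degree G u \<and> degree G u \<le> \<Delta>"
    and graph_with_degrees_min: "\<exists>u\<in>pverts G. degree G u = \<delta>"
    and graph_with_degrees_max: "\<exists>u\<in>pverts G. degree G u = \<Delta>"
proof -
  show pg: "pair_graph G"
    using assms by (simp add: graph_with_degrees_def simple_graph_def)
  interpret pair_graph G by (fact pg)
  show fin: "finite (pverts G)" by (fact pair_finite_verts)
  have ne: "pverts G \<noteq> {}"
    using assms in_arcsD1 by (auto simp: graph_with_degrees_def simple_graph_def)
  have eqs: "\<delta> = Min (degree G ` pverts G)" "\<Delta> = Max (degree G ` pverts G)"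
    using assms by (simp_all add: graph_with_degrees_def min_degree_def max_degree_def)
  show "u \<in> pverts G \<Longrightarrow> \<delta> \<le> degree G u \<and> degree G u \<le> \<Delta>"
    unfolding eqs using fin by simp
  have "\<delta> \<in> degree G ` pverts G" "\<Delta> \<in> degree G ` pverts G"
    unfolding eqs using fin ne by simp_all
  then show "\<exists>u\<in>pverts G. degree G u = \<delta>" "\<exists>u\<in>pverts G. degree G u = \<Delta>"
    by auto
qed

section \<open>Lower bounds for the index\<close>

text \<open>One vertex of degree \<open>\<delta>\<close> is split off; every other degree lies
  between 1 and \<open>\<Delta>\<close>, so it contributes at least
  \<open>h \<Delta>\<close>.\<close>

lemma vertex_index_ge:
  assumes "graph_with_degrees \<delta> \<Delta> G" "1 \<le> \<delta>" "antimono_on {1..} h"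
  shows "h \<delta> + real (card (pverts G) - 1) * h \<Delta> \<le> vertex_index h G"
proof -
  note G = graph_with_degreesD[OF assms(1)]
  obtain u where u: "u \<in> pverts G" "degree G u = \<delta>"
    using G(4) by auto
  have "h \<Delta> \<le> h (degree G v)" if "v \<in> pverts G" for v
    using G(3)[OF that] assms(2) by (intro monotone_onD[OF assms(3)]) auto
  then have "real (card (pverts G - {u})) * h \<Delta> \<le> (\<Sum>v\<in>pverts G - {u}. h (degree G v))"
    by (intro sum_bounded_below) auto
  then show ?thesis
    using u G(2) by (simp add: vertex_index_def sum.remove[OF G(2) u(1)])
qed

text \<open>By the handshake lemma the vertex of degree \<open>\<delta>\<close> cannot be the only one of odd degree.\<close>

lemma vertex_index_ge_odd_even:
  assumes "graph_with_degrees \<delta> \<Delta> G" "odd \<delta>" "even \<Delta>" "antimono_on {1..} h"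
  shows "h \<delta> + h (\<Delta> - 1) + real (card (pverts G) - 2) * h \<Delta> \<le> vertex_index h G"
proof -
  note G = graph_with_degreesD[OF assms(1)]
  interpret pair_graph G by (fact G(1))
  have pos: "1 \<le> \<delta>" using assms(2) by (auto elim: oddE)
  obtain u where u: "u \<in> pverts G" "degree G u = \<delta>"
    using G(4) by auto
  have "\<exists>w\<in>pverts G - {u}. odd (degree G w)"
  proof (rule ccontr)
    assume "\<not> ?thesis"
    then have "even (\<Sum>v\<in>pverts G - {u}. degree G v)"
      by (intro dvd_sum) auto
    then have "odd (degree G u + (\<Sum>v\<in>pverts G - {u}. degree G v))"
      using assms(2) u(2) by simp
    then show False
      using even_sum_degree sum.remove[OF G(2) u(1), of "degree G"] by metis
  qed
  then obtain w where w: "w \<in> pverts G - {u}" "odd (degree G w)"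
    by blast
  have h_le: "h \<Delta> \<le> h (degree G v)" if "v \<in> pverts G" for v
    using G(3)[OF that] pos by (intro monotone_onD[OF assms(4)]) auto
  \<comment> \<open>An odd degree differs from the even \<open>\<Delta>\<close>, so \<open>w\<close>
    costs at least \<open>h (\<Delta> - 1)\<close>.\<close>
  have "degree G w \<le> \<Delta> - 1" "1 \<le> degree G w"
    using G(3)[of w] w assms(3) pos by (auto simp: le_less)
  then have "h (\<Delta> - 1) \<le> h (degree G w)"
    by (intro monotone_onD[OF assms(4)]) auto
  moreover have "real (card (pverts G - {u} - {w})) * h \<Delta>
      \<le> (\<Sum>v\<in>pverts G - {u} - {w}. h (degree G v))"
    using h_le by (intro sum_bounded_below) auto
  moreover have "card (pverts G - {u} - {w}) = card (pverts G) - 2"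
    using u w G(2) by simp
  moreover have "vertex_index h G = h (degree G u) + (h (degree G w)
      + (\<Sum>v\<in>pverts G - {u} - {w}. h (degree G v)))"
    unfolding vertex_index_def sum.remove[OF G(2) u(1)] sum.remove[OF finite_Diff[OF G(2)] w(1)]
    by (rule refl)
  ultimately show ?thesis
    using u(2) by simp
qed

section \<open>Competitors and their complements\<close>

definition complement_graph :: "'a set \<Rightarrow> ('a \<Rightarrow> 'a \<Rightarrow> bool) \<Rightarrow> 'a pair_pre_digraph" where
  "complement_graph V R =
     \<lparr>pverts = V, parcs = {(u, v). u \<in> V \<and> v \<in> V \<and> u \<noteq> v \<and> \<not> R u v}\<rparr>"

lemma pverts_complement_graph [simp]: "pverts (complement_graph V R) = V"
  by (simp add: complement_graph_def)

lemma pair_graph_complement_graph: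
  assumes "finite V" "symp R"
  shows "pair_graph (complement_graph V R)"
proof
  show "finite (parcs (complement_graph V R))"
    using assms(1) by (auto simp: complement_graph_def intro: finite_subset[of _ "V \<times> V"])
  show "symmetric (complement_graph V R)"
    using sympD[OF assms(2)] by (auto simp: complement_graph_def symmetric_def intro!: symI)
qed (use assms(1) in \<open>auto simp: complement_graph_def\<close>)

lemma degree_complement_graph:
  assumes "finite V" "u \<in> V" "{v \<in> V. R u v} = N" "u \<notin> N"
  shows "degree (complement_graph V R) u = card V - 1 - card N"
proof -
  have "{v. (u, v) \<in> parcs (complement_graph V R)} = V - {u} - N"
    using assms by (auto simp: complement_graph_def)
  moreover have "N \<subseteq> V - {u}"
    using assms by auto
  ultimately show ?thesis
    using assms by (simp add: degree_eq_card card_Diff_subset finite_subset)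
qed

text \<open>One orientation of the edges missing in the competitor on \<open>{..<\<Delta> + 2}\<close>: the star from \<open>0\<close> to
  \<open>\<delta> + 1, \<dots>, \<Delta> + 1\<close> and the matching \<open>12, 34, \<dots>\<close> covering \<open>1, \<dots>, \<delta>\<close>.  For odd \<open>\<delta>\<close> the last
  matching edge reaches \<open>\<delta> + 1\<close>, which is the vertex of degree \<open>\<Delta> - 1\<close>.\<close>

definition sparse_complement :: "nat \<Rightarrow> nat \<Rightarrow> nat \<Rightarrow> bool" where
  "sparse_complement \<delta> u v \<longleftrightarrow> u = 0 \<and> \<delta> < v \<or> odd u \<and> u \<le> \<delta> \<and> v = u + 1"

lemma competitor_add_2:
  fixes \<delta> \<Delta> :: nat
  assumes "1 \<le> \<delta>" "\<delta> < \<Delta>"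
  defines "\<Gamma> \<equiv> complement_graph {..<\<Delta> + 2}
             (\<lambda>u v. sparse_complement \<delta> u v \<or> sparse_complement \<delta> v u)"
  shows graph_with_degrees_add_2: "graph_with_degrees \<delta> \<Delta> \<Gamma>"
    and vertex_index_add_2: "vertex_index h \<Gamma> =
      (if even \<delta> then h \<delta> + real (\<Delta> + 1) * h \<Delta>
       else h \<delta> + h (\<Delta> - 1) + real \<Delta> * h \<Delta>)"
proof -
  let ?V = "{..<\<Delta> + 2}"
  let ?R = "\<lambda>u v. sparse_complement \<delta> u v \<or> sparse_complement \<delta> v u"
  have deg: "degree \<Gamma> u = \<Delta> + 1 - card N" if "u \<in> ?V" "{v \<in> ?V. ?R u v} = N" "u \<notin> N" for u N
    unfolding \<Gamma>_def using degree_complement_graph[of ?V u ?R N] that by simp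
  have deg_0: "degree \<Gamma> 0 = \<delta>"
    using assms by (subst deg[where N = "{\<delta> + 1..\<Delta> + 1}"]) (auto simp: sparse_complement_def)
  \<comment> \<open>The only non-neighbour is the matching partner.\<close>
  have deg_low: "degree \<Gamma> u = \<Delta>" if "1 \<le> u" "u \<le> \<delta>" for u
    using assms(1,2) that
    by (subst deg[where N = "{if odd u then u + 1 else u - 1}"])
      (auto simp: sparse_complement_def even_Suc Suc_diff_1 gr0_conv_Suc)
  \<comment> \<open>These are the leaves of the star, which miss 0; for odd \<open>\<delta>\<close>
    the leaf \<open>\<delta> + 1\<close> also misses its partner \<open>\<delta>\<close>.\<close>
  have deg_high: "degree \<Gamma> u = (if u = \<delta> + 1 \<and> odd \<delta> then \<Delta> - 1 else \<Delta>)"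
    if "\<delta> < u" "u < \<Delta> + 2" for u
    using assms that
    by (subst deg[where N = "if u = \<delta> + 1 \<and> odd \<delta> then {0, \<delta>} else {0}"])
      (auto simp: sparse_complement_def less_Suc_eq_le dest: le_antisym split: if_splits)
  have degs: "degree \<Gamma> u = (if u = 0 then \<delta> else if u = \<delta> + 1 \<and> odd \<delta> then \<Delta> - 1 else \<Delta>)"
    if "u < \<Delta> + 2" for u
    using deg_0 deg_low[of u] deg_high[of u] that by (cases "u = 0"; cases "u \<le> \<delta>") auto
  have verts: "pverts \<Gamma> = ?V"
    by (simp add: \<Gamma>_def)
  show "graph_with_degrees \<delta> \<Delta> \<Gamma>"
  proof (rule graph_with_degreesI[where u = 0 and v = 1])
    show "pair_graph \<Gamma>"
      unfolding \<Gamma>_def by (intro pair_graph_complement_graph) (auto intro: sympI)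
  qed (use assms(1,2) degs in \<open>auto simp: verts\<close>)
  let ?f = "\<lambda>u. if u = 0 then \<delta> else if u = \<delta> + 1 \<and> odd \<delta> then \<Delta> - 1 else \<Delta>"
  have "vertex_index h \<Gamma> = (\<Sum>u\<in>?V. h (?f u))"
    unfolding vertex_index_def verts using degs by (intro sum.cong) auto
  also have "\<dots> = h (?f 0) + (\<Sum>u\<in>?V - {0}. h (?f u))"
    by (rule sum.remove) auto
  \<comment> \<open>For even \<open>\<delta>\<close> the vertex \<open>\<delta> + 1\<close> is
    ordinary; singling it out anyway serves both parities and leaves \<open>\<Delta>\<close>
    vertices of degree \<open>\<Delta>\<close>.\<close>
  also have "(\<Sum>u\<in>?V - {0}. h (?f u)) = h (?f (\<delta> + 1)) + (\<Sum>u\<in>?V - {0} - {\<delta> + 1}. h (?f u))"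
    by (rule sum.remove) (use assms(2) in auto)
  also have "(\<Sum>u\<in>?V - {0} - {\<delta> + 1}. h (?f u)) = (\<Sum>u\<in>?V - {0} - {\<delta> + 1}. h \<Delta>)"
    by (intro sum.cong) auto
  also have "\<dots> = real \<Delta> * h \<Delta>"
    using assms(1,2) by simp
  finally show "vertex_index h \<Gamma> =
      (if even \<delta> then h \<delta> + real (\<Delta> + 1) * h \<Delta>
       else h \<delta> + h (\<Delta> - 1) + real \<Delta> * h \<Delta>)"
    by (simp add: algebra_simps)
qed

text \<open>On \<open>{..<\<Delta> + 3}\<close> every vertex except \<open>0\<close> misses exactly two others: the star from \<open>0\<close> to
  \<open>\<delta> + 1, \<dots>, \<Delta> + 2\<close> is completed by the path \<open>\<Delta> + 2, 1, 2, \<dots>, \<delta> + 1\<close> and a perfect matching of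
  the remaining leaves \<open>\<delta> + 2, \<dots>, \<Delta> + 1\<close>.\<close>

definition odd_complement :: "nat \<Rightarrow> nat \<Rightarrow> nat \<Rightarrow> nat \<Rightarrow> bool" where
  "odd_complement \<delta> \<Delta> u v \<longleftrightarrow>
     u = 0 \<and> \<delta> < v \<or> 1 \<le> u \<and> u \<le> \<Delta> \<and> (odd u \<or> u \<le> \<delta>) \<and> v = u + 1 \<or> u = 1 \<and> v = \<Delta> + 2"

text \<open>The matching exists because its \<open>\<Delta> - \<delta>\<close> leaves are even in
  number. Each nonzero vertex then has degree \<open>\<Delta> + 2 - 2\<close>.\<close>

lemma competitor_add_3:
  fixes \<delta> \<Delta> :: nat
  assumes "odd \<delta>" "odd \<Delta>" "\<delta> < \<Delta>"
  defines "\<Gamma> \<equiv> complement_graph {..<\<Delta> + 3}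
             (\<lambda>u v. odd_complement \<delta> \<Delta> u v \<or> odd_complement \<delta> \<Delta> v u)"
  shows graph_with_degrees_add_3: "graph_with_degrees \<delta> \<Delta> \<Gamma>"
    and vertex_index_add_3: "vertex_index h \<Gamma> = h \<delta> + real (\<Delta> + 2) * h \<Delta>"
proof -
  let ?V = "{..<\<Delta> + 3}"
  let ?R = "\<lambda>u v. odd_complement \<delta> \<Delta> u v \<or> odd_complement \<delta> \<Delta> v u"
  have pos: "1 \<le> \<delta>" using assms(1) by (auto elim: oddE)
  have deg: "degree \<Gamma> u = \<Delta> + 2 - card N" if "u \<in> ?V" "{v \<in> ?V. ?R u v} = N" "u \<notin> N" for u N
    unfolding \<Gamma>_def using degree_complement_graph[of ?V u ?R N] that by simp
  have deg_0: "degree \<Gamma> 0 = \<delta>"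
    using assms pos by (subst deg[where N = "{\<delta> + 1..\<Delta> + 2}"]) (auto simp: odd_complement_def)
  have deg_low: "degree \<Gamma> u = \<Delta>" if "1 \<le> u" "u \<le> \<delta>" for u
    using assms that
    by (subst deg[where N = "{if u = 1 then \<Delta> + 2 else u - 1, u + 1}"])
      (auto simp: odd_complement_def)
  have deg_high: "degree \<Gamma> u = \<Delta>" if "\<delta> < u" "u < \<Delta> + 3" for u
  proof -
    \<comment> \<open>The non-neighbour other than 0: the path neighbour for
      \<open>\<Delta> + 2\<close> and \<open>\<delta> + 1\<close>, the matching partner
      otherwise.\<close>
    define m where "m = (if u = \<Delta> + 2 then 1 else if odd u then u + 1 else u - 1)"
    have "{v \<in> ?V. ?R u v} = {0, m}"
    proof (intro set_eqI)
      fix v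
      have "u = \<Delta> + 2 \<or> u = \<Delta> + 1 \<or> u \<le> \<Delta>"
        using that by linarith
      then consider "u = \<Delta> + 2" | "u = \<Delta> + 1" | "u \<le> \<Delta>" "odd u" | "u \<le> \<Delta>" "even u"
        by blast
      then show "v \<in> {v \<in> ?V. ?R u v} \<longleftrightarrow> v \<in> {0, m}"
        using that pos assms(1-3) unfolding odd_complement_def m_def
        by cases (auto simp: gr0_conv_Suc even_Suc le_less)
    qed
    moreover have "m \<noteq> 0" "m \<noteq> u" "u \<noteq> 0"
      using that pos assms by (auto simp: m_def)
    ultimately show ?thesis
      using that by (subst deg[where N = "{0, m}"]) auto
  qed
  have degs: "degree \<Gamma> u = (if u = 0 then \<delta> else \<Delta>)" if "u < \<Delta> + 3" for u
    using deg_0 deg_low[of u] deg_high[of u] that by (cases "u = 0"; cases "u \<le> \<delta>") auto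
  have verts: "pverts \<Gamma> = ?V"
    by (simp add: \<Gamma>_def)
  show "graph_with_degrees \<delta> \<Delta> \<Gamma>"
  proof (rule graph_with_degreesI[where u = 0 and v = 1])
    show "pair_graph \<Gamma>"
      unfolding \<Gamma>_def by (intro pair_graph_complement_graph) (auto intro: sympI)
  qed (use assms(3) pos degs in \<open>auto simp: verts\<close>)
  have split: "?V = insert 0 {1..\<Delta> + 2}"
    by auto
  have "vertex_index h \<Gamma> = (\<Sum>u\<in>?V. h (if u = 0 then \<delta> else \<Delta>))"
    unfolding vertex_index_def verts using degs by (intro sum.cong) auto
  also have "\<dots> = h \<delta> + real (\<Delta> + 2) * h \<Delta>"
    unfolding split by simp
  finally show "vertex_index h \<Gamma> = h \<delta> + real (\<Delta> + 2) * h \<Delta>" .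
qed

section \<open>Comparison of \<open>G\<close> with the competitors\<close>

theorem theorem2p16:
  fixes \<delta> \<Delta> :: nat and h :: "nat \<Rightarrow> real" and G :: "'a pair_pre_digraph"
  assumes "1 \<le> \<delta>" and "\<delta> < \<Delta>"
    and "\<And>k. 1 \<le> k \<Longrightarrow> 0 < h k"
    and "antimono_on {1..} h"
    and "minimal_graph h \<delta> \<Delta> G"
  shows "(even (\<delta> * \<Delta>) \<longrightarrow>
            \<Delta> + 1 \<le> card (pverts G) \<and> card (pverts G) \<le> \<Delta> + 2) \<and>
         (odd (\<delta> * \<Delta>) \<and> 2 * h \<Delta> > h (\<Delta> - 1) \<longrightarrow>
            \<Delta> + 1 \<le> card (pverts G) \<and> card (pverts G) \<le> \<Delta> + 2) \<and>
         (odd (\<delta> * \<Delta>) \<and> 2 * h \<Delta> \<le> h (\<Delta> - 1) \<longrightarrow>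
            \<Delta> + 1 \<le> card (pverts G) \<and> card (pverts G) \<le> \<Delta> + 3)"
proof -
  let ?n = "card (pverts G)"
  have G: "graph_with_degrees \<delta> \<Delta> G"
    and minimal: "\<And>\<Gamma> :: nat pair_pre_digraph.
      graph_with_degrees \<delta> \<Delta> \<Gamma> \<Longrightarrow> vertex_index h G \<le> vertex_index h \<Gamma>"
    using assms(5) by (auto simp: minimal_graph_def)
  have pos: "0 < h \<Delta>"
    using assms(1-3) by simp
  \<comment> \<open>A vertex of degree \<open>\<Delta>\<close> and its neighbours make
    \<open>\<Delta> + 1\<close> vertices.\<close>
  have lower: "\<Delta> + 1 \<le> ?n"
    using graph_with_degrees_max[OF G]
      pair_graph.degree_less_card[OF graph_with_degrees_pair_graph[OF G]] by force
  have ge: "h \<delta> + real m * h \<Delta> \<le> vertex_index h G" if "m + 1 \<le> ?n" for m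
  proof -
    have "real m * h \<Delta> \<le> real (?n - 1) * h \<Delta>"
      using that pos by (intro mult_right_mono) auto
    then show ?thesis using vertex_index_ge[OF G assms(1,4)] by linarith
  qed
  have le_2: "vertex_index h G \<le> (if even \<delta> then h \<delta> + real (\<Delta> + 1) * h \<Delta>
       else h \<delta> + h (\<Delta> - 1) + real \<Delta> * h \<Delta>)"
    using minimal[OF graph_with_degrees_add_2[OF assms(1,2)]]
    unfolding vertex_index_add_2[OF assms(1,2)] .
  have "?n \<le> \<Delta> + 2" if "even (\<delta> * \<Delta>)"
  proof (rule ccontr)
    assume "\<not> ?n \<le> \<Delta> + 2"
    then have n: "\<Delta> + 3 \<le> ?n" by simp
    show False
    proof (cases "even \<delta>")
      case True
      \<comment> \<open>The lower bound exceeds the competitor's index by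
        \<open>h \<Delta>\<close>.\<close>
      then show False
        using ge[of "\<Delta> + 2"] le_2 n pos by (simp add: algebra_simps)
    next
      case False
      then have "even \<Delta>" using that by simp
      \<comment> \<open>The term \<open>h (\<Delta> - 1)\<close> occurs in both bounds and cancels,
        leaving \<open>\<Delta> + 1\<close> against \<open>\<Delta>\<close> copies of
        \<open>h \<Delta>\<close>.\<close>
      have "real (\<Delta> + 1) * h \<Delta> \<le> real (?n - 2) * h \<Delta>"
        using n pos by (intro mult_right_mono) auto
      then show False
        using vertex_index_ge_odd_even[OF G False \<open>even \<Delta>\<close> assms(4)] le_2 False pos
        by (simp add: algebra_simps)
    qed
  qed
  \<comment> \<open>With \<open>\<Delta> + 3\<close> or more vertices, minimality would give
    \<open>(\<Delta> + 2) * h \<Delta> \<le> h (\<Delta> - 1) + \<Delta> * h \<Delta>\<close>, that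
    is, \<open>2 * h \<Delta> \<le> h (\<Delta> - 1)\<close>.\<close>
  moreover have "?n \<le> \<Delta> + 2" if "odd (\<delta> * \<Delta>)" "2 * h \<Delta> > h (\<Delta> - 1)"
  proof (rule ccontr)
    assume "\<not> ?n \<le> \<Delta> + 2"
    then show False
      using ge[of "\<Delta> + 2"] le_2 that by (simp add: algebra_simps)
  qed
  \<comment> \<open>Here \<open>h (\<Delta> - 1)\<close> may be large, so the comparison is with the
    competitor on \<open>\<Delta> + 3\<close> vertices, whose index avoids it.\<close>
  moreover have "?n \<le> \<Delta> + 3" if "odd (\<delta> * \<Delta>)"
  proof (rule ccontr)
    assume "\<not> ?n \<le> \<Delta> + 3"
    moreover have odd: "odd \<delta>" "odd \<Delta>"
      using that by simp_all
    moreover have "vertex_index h G \<le> h \<delta> + real (\<Delta> + 2) * h \<Delta>"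
      using minimal[OF graph_with_degrees_add_3[OF odd assms(2)]]
      unfolding vertex_index_add_3[OF odd assms(2)] .
    ultimately show False
      using ge[of "\<Delta> + 3"] pos by (simp add: algebra_simps)
  qed
  ultimately show ?thesis using lower by blast
qed

end
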